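(* Let $(X,d)$ be a metric space with at least two points and let $\mathcal{B}$ be a bornology on $X$ with a closed base. Then $\chi(C(X),\tau_{\mathcal{B}}^{sw}) = dn_{\mathcal{B}}^s(X)\cdot w_{X}(\mathcal{B})$.
   Context: A bornology on $X$ is a family $\mathcal{B}$ of nonempty subsets of $X$ that covers $X$ and is an ideal, i.e. is closed under finite unions and under passing to nonempty subsets. A base for $\mathcal{B}$ is a subfamily $\mathcal{B}_0\subseteq\mathcal{B}$ such that every $B\in\mathcal{B}$ is contained in some $B'\in\mathcal{B}_0$; $\mathcal{B}$ has a closed base if it has a base all of whose members are closed in $(X,d)$. The weight of $\mathcal{B}$ is $w_X(\mathcal{B})=\aleph_0+\min\{|\mathcal{B}_0| : \mathcal{B}_0 \text{ is a base for } \mathcal{B}\}$. $C(X)$ is the set of continuous functions $X\to\mathbb{R}$, and $C^+(X)$ the set of continuous functions $X\to(0,\infty)$. For $A\subseteq X$ nonempty and $\delta>0$, $A^\delta=\bigcup_{x\in A}\{y\in X: d(x,y)<\delta\}$. The topology $\tau_{\mathcal{B}}^{sw}$ of strong Whitney convergence on $\mathcal{B}$ is the topology on $C(X)$ induced by the uniformity having as a base the sets $[B,\epsilon]^{sw}=\{(f,g): \exists\,\delta>0\ \forall x\in B^\delta,\ |f(x)-g(x)|<\epsilon(x)\}$ with $B\in\mathcal{B}$, $\epsilon\in C^+(X)$. A set $F\subseteq C(X)$ is strongly dominating with respect to $\mathcal{B}$ if for every $f\in C(X)$ and every $B\in\mathcal{B}$ there exist $\delta>0$ and $g\in F$ with $f(x)\le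 g(x)$ for all $x\in B^\delta$. The strong domination number is $dn_{\mathcal{B}}^s(X)=\aleph_0+\min\{|F|: F\subseteq C(X)\text{ is strongly dominating with respect to }\mathcal{B}\}$. For a topological space $Y$ and $y\in Y$, $\chi(Y,y)=\aleph_0+\min\{|\mathscr{B}_y|:\mathscr{B}_y\text{ is a local base of }Y\text{ at }y\}$, and the character of $Y$ is $\chi(Y)=\sup\{\chi(Y,y):y\in Y\}$. *)

theory Defs
  imports "HOL-Analysis.Analysis"
begin

unbundle cardinal_syntax
no_notation elt_set_eq (infix \<open>=o\<close> 50)

section \<open>Cardinals\<close>

text \<open>Cardinal numbers are cardinal orders (\<open>Card_order\<close>), compared by \<open>=o\<close> and \<open>\<le>o\<close>.
  The results of the next two definitions are determined only up to \<open>=o\<close>.\<close>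

definition min_card :: "'b set set \<Rightarrow> 'b rel" where
  "min_card \<S> = (SOME r. r \<in> card_of ` \<S> \<and> (\<forall>F\<in>\<S>. r \<le>o |F| ))"

lemma min_card:
  assumes "\<S> \<noteq> {}"
  shows "min_card \<S> \<in> card_of ` \<S>" "F \<in> \<S> \<Longrightarrow> min_card \<S> \<le>o |F|"
proof -
  have "\<exists>r\<in>card_of ` \<S>. \<forall>r'\<in>card_of ` \<S>. r \<le>o r'"
    using assms by (intro exists_minim_Card_order) (auto simp: card_of_Card_order)
  then have "\<exists>r. r \<in> card_of ` \<S> \<and> (\<forall>F\<in>\<S>. r \<le>o |F| )"
    by blast
  from someI_ex[OF this]
  show "min_card \<S> \<in> card_of ` \<S>" "F \<in> \<S> \<Longrightarrow> min_card \<S> \<le>o |F|"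
    unfolding min_card_def by blast+
qed

text \<open>Every cardinal order on the type \<open>'b\<close> is at most \<open>|UNIV|\<close>, so upper bounds on that type
  exist, and the least of them is also the least among those on any other type
  (\<open>csup_least\<close> below).\<close>

definition csup :: "'b rel set \<Rightarrow> 'b rel" where
  "csup R = (SOME s. (Card_order s \<and> (\<forall>r\<in>R. r \<le>o s)) \<and>
                     (\<forall>s' :: 'b rel. Card_order s' \<and> (\<forall>r\<in>R. r \<le>o s') \<longrightarrow> s \<le>o s'))"

lemma
  fixes R :: "'b rel set"
  assumes R: "\<And>r. r \<in> R \<Longrightarrow> Card_order r"
  shows Card_order_csup: "Card_order (csup R)"
    and csup_upper: "r \<in> R \<Longrightarrow> r \<le>o csup R"
    and csup_least: "\<lbrakk>Card_order (t :: 'c rel); \<And>r. r \<in> R \<Longrightarrow> r \<le>o t\<rbrakk> \<Longrightarrow> csup R \<le>o t"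
proof -
  let ?U = "{s :: 'b rel. Card_order s \<and> (\<forall>r\<in>R. r \<le>o s)}"
  have le_UNIV: "r \<le>o |UNIV :: 'b set|" if "r \<in> R" for r
    using card_of_Field_ordIso[OF R[OF that]] card_of_mono1[OF subset_UNIV]
    by (meson ordIso_ordLeq_trans ordIso_symmetric)
  then have "|UNIV :: 'b set| \<in> ?U"
    using card_of_Card_order by blast
  then have "\<exists>s\<in>?U. \<forall>s'\<in>?U. s \<le>o s'"
    by (intro exists_minim_Card_order) blast+
  then have "\<exists>s :: 'b rel. (Card_order s \<and> (\<forall>r\<in>R. r \<le>o s)) \<and>
               (\<forall>s' :: 'b rel. Card_order s' \<and> (\<forall>r\<in>R. r \<le>o s') \<longrightarrow> s \<le>o s')"
    by blast
  from someI_ex[OF this]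
  have *: "Card_order (csup R)" "\<And>r. r \<in> R \<Longrightarrow> r \<le>o csup R"
    and least: "\<And>s' :: 'b rel. Card_order s' \<Longrightarrow> \<forall>r\<in>R. r \<le>o s' \<Longrightarrow> csup R \<le>o s'"
    unfolding csup_def by blast+
  show "Card_order (csup R)" by fact
  show "r \<in> R \<Longrightarrow> r \<le>o csup R" by fact
  assume t: "Card_order t" "\<And>r. r \<in> R \<Longrightarrow> r \<le>o t"
  show "csup R \<le>o t"
  proof (rule ccontr)
    assume "\<not> csup R \<le>o t"
    then have less: "t <o csup R"
      using * t(1) by (meson card_order_on_well_order_on not_ordLeq_iff_ordLess)
    obtain p :: "'b rel" where p: "t =o p" "p <o csup R"
      using iffD1[OF internalize_ordLess less] by blast
    have "Card_order p"
      by (rule Card_order_ordIso2[OF t(1) p(1)])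
    moreover have "\<forall>r\<in>R. r \<le>o p"
      by (intro ballI ordLeq_ordIso_trans[OF t(2) p(1)])
    ultimately have "csup R \<le>o p"
      using least by blast
    with p(2) show False
      by (simp add: not_ordLess_ordLeq)
  qed
qed

section \<open>Character of a topological space\<close>

definition local_base :: "'b topology \<Rightarrow> 'b \<Rightarrow> 'b set set \<Rightarrow> bool" where
  "local_base Y y \<V> \<longleftrightarrow>
     (\<forall>V\<in>\<V>. openin Y V \<and> y \<in> V) \<and>
     (\<forall>U. openin Y U \<and> y \<in> U \<longrightarrow> (\<exists>V\<in>\<V>. V \<subseteq> U))"

definition character_at :: "'b topology \<Rightarrow> 'b \<Rightarrow> (nat + 'b set) rel" where
  "character_at Y y = natLeq +c min_card {\<V>. local_base Y y \<V>}"

definition character :: "'b topology \<Rightarrow> (nat + 'b set) rel" where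
  "character Y = csup (character_at Y ` topspace Y)"

section \<open>Bornologies\<close>

text \<open>The metric space is the type \<open>'a::metric_space\<close>.\<close>

definition bornology :: "'a set set \<Rightarrow> bool" where
  "bornology \<B> \<longleftrightarrow>
     {} \<notin> \<B> \<and> \<Union>\<B> = UNIV \<and>
     (\<forall>A\<in>\<B>. \<forall>B\<in>\<B>. A \<union> B \<in> \<B>) \<and>
     (\<forall>B\<in>\<B>. \<forall>A. A \<subseteq> B \<and> A \<noteq> {} \<longrightarrow> A \<in> \<B>)"

definition bornology_base :: "'a set set \<Rightarrow> 'a set set \<Rightarrow> bool" where
  "bornology_base \<B> \<B>\<^sub>0 \<longleftrightarrow> \<B>\<^sub>0 \<subseteq> \<B> \<and> (\<forall>B\<in>\<B>. \<exists>B'\<in>\<B>\<^sub>0. B \<subseteq> B')"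

definition has_closed_base :: "'a::metric_space set set \<Rightarrow> bool" where
  "has_closed_base \<B> \<longleftrightarrow> (\<exists>\<B>\<^sub>0. bornology_base \<B> \<B>\<^sub>0 \<and> (\<forall>B\<in>\<B>\<^sub>0. closed B))"

definition bornology_weight :: "'a set set \<Rightarrow> (nat + 'a set) rel" where
  "bornology_weight \<B> = natLeq +c min_card {\<B>\<^sub>0. bornology_base \<B> \<B>\<^sub>0}"

section \<open>Strong Whitney convergence\<close>

definition cont_funs :: "('a::metric_space \<Rightarrow> real) set" where
  "cont_funs = {f. continuous_on UNIV f}"

definition pos_cont_funs :: "('a::metric_space \<Rightarrow> real) set" where
  "pos_cont_funs = {f \<in> cont_funs. \<forall>x. 0 < f x}"

definition enlargement :: "'a::metric_space set \<Rightarrow> real \<Rightarrow> 'a set" where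
  "enlargement A \<delta> = (\<Union>x\<in>A. ball x \<delta>)"

definition sw_entourage ::
    "'a::metric_space set \<Rightarrow> ('a \<Rightarrow> real) \<Rightarrow> (('a \<Rightarrow> real) \<times> ('a \<Rightarrow> real)) set" where
  "sw_entourage B \<epsilon> = {(f, g). f \<in> cont_funs \<and> g \<in> cont_funs \<and>
     (\<exists>\<delta>>0. \<forall>x\<in>enlargement B \<delta>. \<bar>f x - g x\<bar> < \<epsilon> x)}"

text \<open>As in the class \<open>uniform_space\<close>, a uniformity is the filter of its entourages, and a set
  is open if it contains a uniform neighbourhood of each of its points. That the entourages
  \<open>sw_entourage B \<epsilon>\<close> form a base of the filter, not just a subbase, is
  \<open>eventually_sw_uniformity\<close>.\<close>

definition sw_uniformity ::
    "'a::metric_space set set \<Rightarrow> (('a \<Rightarrow> real) \<times> ('a \<Rightarrow> real)) filter" where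
  "sw_uniformity \<B> = (INF (B, \<epsilon>)\<in>\<B> \<times> pos_cont_funs. principal (sw_entourage B \<epsilon>))"

definition sw_topology :: "'a::metric_space set set \<Rightarrow> ('a \<Rightarrow> real) topology" where
  "sw_topology \<B> = topology (\<lambda>U. U \<subseteq> cont_funs \<and>
     (\<forall>f\<in>U. \<forall>\<^sub>F (f', g) in sw_uniformity \<B>. f' = f \<longrightarrow> g \<in> U))"

lemma openin_sw_topology:
  "openin (sw_topology \<B>) U \<longleftrightarrow> U \<subseteq> cont_funs \<and>
     (\<forall>f\<in>U. \<forall>\<^sub>F (f', g) in sw_uniformity \<B>. f' = f \<longrightarrow> g \<in> U)"
proof -
  have "istopology (\<lambda>U. U \<subseteq> cont_funs \<and>
     (\<forall>f\<in>U. \<forall>\<^sub>F (f', g) in sw_uniformity \<B>. f' = f \<longrightarrow> g \<in> U))"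
    unfolding istopology_def
  proof (intro conjI allI impI ballI)
    fix S T f
    assume S: "S \<subseteq> cont_funs \<and> (\<forall>f\<in>S. \<forall>\<^sub>F (f', g) in sw_uniformity \<B>. f' = f \<longrightarrow> g \<in> S)"
      and T: "T \<subseteq> cont_funs \<and> (\<forall>f\<in>T. \<forall>\<^sub>F (f', g) in sw_uniformity \<B>. f' = f \<longrightarrow> g \<in> T)"
    then show "S \<inter> T \<subseteq> cont_funs" by blast
    assume "f \<in> S \<inter> T"
    with S T have "\<forall>\<^sub>F (f', g) in sw_uniformity \<B>. f' = f \<longrightarrow> g \<in> S"
      "\<forall>\<^sub>F (f', g) in sw_uniformity \<B>. f' = f \<longrightarrow> g \<in> T" by auto
    then show "\<forall>\<^sub>F (f', g) in sw_uniformity \<B>. f' = f \<longrightarrow> g \<in> S \<inter> T"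
      by eventually_elim auto
  next
    fix \<K> f
    assume K: "\<forall>U\<in>\<K>. U \<subseteq> cont_funs \<and>
      (\<forall>f\<in>U. \<forall>\<^sub>F (f', g) in sw_uniformity \<B>. f' = f \<longrightarrow> g \<in> U)"
    then show "\<Union>\<K> \<subseteq> cont_funs" by blast
    assume "f \<in> \<Union>\<K>"
    then obtain U where U: "U \<in> \<K>" "f \<in> U" by blast
    with K have "\<forall>\<^sub>F (f', g) in sw_uniformity \<B>. f' = f \<longrightarrow> g \<in> U" by blast
    then show "\<forall>\<^sub>F (f', g) in sw_uniformity \<B>. f' = f \<longrightarrow> g \<in> \<Union>\<K>"
      by eventually_elim (use U in auto)
  qed
  then show ?thesis
    unfolding sw_topology_def by (simp add: topology_inverse')
qed

lemma eventually_sw_uniformity: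
  assumes "bornology \<B>"
  shows "eventually P (sw_uniformity \<B>) \<longleftrightarrow>
    (\<exists>B\<in>\<B>. \<exists>\<epsilon>\<in>pos_cont_funs. \<forall>p\<in>sw_entourage B \<epsilon>. P p)"
proof -
  have ne: "\<B> \<times> (pos_cont_funs :: ('a \<Rightarrow> real) set) \<noteq> {}"
  proof -
    have "\<B> \<noteq> {}" using assms unfolding bornology_def by auto
    moreover have "(\<lambda>_. 1 :: real) \<in> pos_cont_funs"
      by (simp add: pos_cont_funs_def cont_funs_def)
    ultimately show ?thesis by blast
  qed
  have "\<exists>r\<in>\<B> \<times> pos_cont_funs. (case r of (B, \<epsilon>) \<Rightarrow> principal (sw_entourage B \<epsilon>)) \<le>
      inf (case p of (B, \<epsilon>) \<Rightarrow> principal (sw_entourage B \<epsilon>))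
        (case q of (B, \<epsilon>) \<Rightarrow> principal (sw_entourage B \<epsilon>))"
    if "p \<in> \<B> \<times> pos_cont_funs" "q \<in> \<B> \<times> pos_cont_funs" for p q
  proof -
    obtain B \<epsilon> C \<eta> where pq: "p = (B, \<epsilon>)" "q = (C, \<eta>)" by (cases p, cases q)
    have mem: "(B \<union> C, \<lambda>x. min (\<epsilon> x) (\<eta> x)) \<in> \<B> \<times> pos_cont_funs"
      using that assms
      by (auto simp: pq bornology_def pos_cont_funs_def cont_funs_def intro!: continuous_intros)
    have "sw_entourage (B \<union> C) (\<lambda>x. min (\<epsilon> x) (\<eta> x)) \<subseteq> sw_entourage B \<epsilon> \<inter> sw_entourage C \<eta>"
    proof
      fix p assume "p \<in> sw_entourage (B \<union> C) (\<lambda>x. min (\<epsilon> x) (\<eta> x))"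
      then obtain f g \<delta> where *: "p = (f, g)" "f \<in> cont_funs" "g \<in> cont_funs" "\<delta> > 0"
        "\<And>x. x \<in> enlargement (B \<union> C) \<delta> \<Longrightarrow> \<bar>f x - g x\<bar> < min (\<epsilon> x) (\<eta> x)"
        unfolding sw_entourage_def by blast
      have "\<bar>f x - g x\<bar> < \<epsilon> x" if "x \<in> enlargement B \<delta>" for x
        using *(5)[of x] that by (simp add: enlargement_def)
      moreover have "\<bar>f x - g x\<bar> < \<eta> x" if "x \<in> enlargement C \<delta>" for x
        using *(5)[of x] that by (simp add: enlargement_def)
      ultimately show "p \<in> sw_entourage B \<epsilon> \<inter> sw_entourage C \<eta>"
        using *(1-4) unfolding sw_entourage_def by blast
    qed
    with mem show ?thesis
      by (intro bexI[of _ "(B \<union> C, \<lambda>x. min (\<epsilon> x) (\<eta> x))"]) (auto simp: pq)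
  qed
  then have "eventually P (sw_uniformity \<B>) \<longleftrightarrow>
    (\<exists>b\<in>\<B> \<times> pos_cont_funs. eventually P (case b of (B, \<epsilon>) \<Rightarrow> principal (sw_entourage B \<epsilon>)))"
    unfolding sw_uniformity_def by (intro eventually_INF_base ne)
  then show ?thesis
    by (auto simp: eventually_principal)
qed

lemma topspace_sw_topology:
  assumes "bornology \<B>"
  shows "topspace (sw_topology \<B>) = cont_funs"
proof -
  obtain B where "B \<in> \<B>"
    using assms unfolding bornology_def by auto
  moreover have "(\<lambda>_. 1 :: real) \<in> pos_cont_funs"
    by (simp add: pos_cont_funs_def cont_funs_def)
  ultimately have "openin (sw_topology \<B>) cont_funs"
    unfolding openin_sw_topology eventually_sw_uniformity[OF assms]
    by (auto simp: sw_entourage_def)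
  moreover have "topspace (sw_topology \<B>) \<subseteq> cont_funs"
    using openin_topspace[of "sw_topology \<B>"] unfolding openin_sw_topology by blast
  ultimately show ?thesis
    using openin_subset by blast
qed

section \<open>Strong domination\<close>

definition strongly_dominating ::
    "'a::metric_space set set \<Rightarrow> ('a \<Rightarrow> real) set \<Rightarrow> bool" where
  "strongly_dominating \<B> F \<longleftrightarrow> F \<subseteq> cont_funs \<and>
     (\<forall>f\<in>cont_funs. \<forall>B\<in>\<B>. \<exists>\<delta>>0. \<exists>g\<in>F. \<forall>x\<in>enlargement B \<delta>. f x \<le> g x)"

definition strong_domination_number ::
    "'a::metric_space set set \<Rightarrow> (nat + ('a \<Rightarrow> real)) rel" where
  "strong_domination_number \<B> = natLeq +c min_card {F. strongly_dominating \<B> F}"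

end

theory Submission
  imports Defs
begin

text \<open>In fact the character of the topology of strong Whitney convergence at every single
  function \<open>f\<close> is the product of the strong domination number and the weight of \<open>\<B>\<close>. Basic
  neighbourhoods of \<open>f\<close> have two independent parameters: a set \<open>B\<close> and a tolerance \<open>\<epsilon>\<close>. The weight
  measures how many sets are needed, and, because \<open>\<epsilon>\<close> may be shrunk exactly when \<open>1/\<epsilon>\<close> may be
  raised, the domination number measures how many tolerances are needed.

  For the upper bound (\<open>local_base_of_base_and_dominating\<close>), a base of \<open>\<B>\<close> and a strongly
  dominating set yield a local base consisting of the neighbourhoods with parameters \<open>B\<close> and
  \<open>1/(1 + \<bar>g\<bar>)\<close>, one for each pair \<open>(B, g)\<close>.

  For the lower bound, every member \<open>V\<close> of a local base contains a basic neighbourhood, with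
  parameters \<open>B\<^sub>V\<close> and \<open>\<epsilon>\<^sub>V\<close>, where \<open>B\<^sub>V\<close> may be taken closed. The sets \<open>B\<^sub>V\<close> form a base,
  since shrinking a basic neighbourhood cannot shrink the closure of its set
  (\<open>subset_closure_of_sw_entourage_subset\<close>). The functions \<open>2/\<epsilon>\<^sub>V\<close> are strongly dominating,
  since the neighbourhood of \<open>f\<close> with tolerance \<open>\<epsilon>\<^sub>V\<close> contains \<open>f + \<epsilon>\<^sub>V/2\<close>
  (\<open>tolerance_le_of_sw_entourage_subset\<close>).\<close>

section \<open>Infinite cardinals given as minima\<close>

lemma min_card_attained:
  assumes "\<S> \<noteq> {}"
  obtains F where "F \<in> \<S>" "min_card \<S> = |F|"
  using min_card(1)[OF assms] by blast

lemma Card_order_min_card: "\<S> \<noteq> {} \<Longrightarrow> Card_order (min_card \<S>)"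
  by (metis min_card_attained card_of_Card_order)

lemma Cinfinite_natLeq_csum: "Cinfinite (natLeq +c r)"
  by (simp add: Cinfinite_csum natLeq_Cinfinite)

lemma natLeq_csum_min_card_le:
  assumes "F \<in> \<S>" "|F| \<le>o r" "Cinfinite r"
  shows "natLeq +c min_card \<S> \<le>o r"
proof (rule csum_cinfinite_bound)
  have "\<S> \<noteq> {}" using assms(1) by blast
  then show "min_card \<S> \<le>o r" "Card_order (min_card \<S>)"
    using min_card(2)[of \<S> F] assms Card_order_min_card ordLeq_transitive by blast+
  show "natLeq \<le>o r" using assms(3) by (simp add: cinfinite_def natLeq_ordLeq_cinfinite)
qed (simp_all add: assms natLeq_Card_order)

lemma min_card_le_natLeq_csum: "\<S> \<noteq> {} \<Longrightarrow> min_card \<S> \<le>o natLeq +c min_card \<S>"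
  by (simp add: ordLeq_csum2 Card_order_min_card)

section \<open>Basic neighbourhoods\<close>

lemma enlargement_mono: "A \<subseteq> B \<Longrightarrow> \<delta> \<le> \<delta>' \<Longrightarrow> enlargement A \<delta> \<subseteq> enlargement B \<delta>'"
  unfolding enlargement_def by fastforce

lemma mem_enlargement_iff_infdist:
  assumes "B \<noteq> {}"
  shows "x \<in> enlargement B \<delta> \<longleftrightarrow> infdist x B < \<delta>"
proof
  assume "x \<in> enlargement B \<delta>"
  then obtain b where "b \<in> B" "dist x b < \<delta>"
    by (auto simp: enlargement_def dist_commute)
  then show "infdist x B < \<delta>" using infdist_le[of b B x] by linarith
next
  assume "infdist x B < \<delta>"
  then obtain b where "b \<in> B" "dist x b < \<delta>"
    using assms cInf_lessD[of "dist x ` B" \<delta>] by (auto simp: infdist_notempty)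
  then show "x \<in> enlargement B \<delta>"
    by (auto simp: enlargement_def dist_commute)
qed

lemma subset_enlargement: "0 < \<delta> \<Longrightarrow> B \<subseteq> enlargement B \<delta>"
  by (auto simp: enlargement_def)

lemma mem_sw_entourage_iff:
  "(f, g) \<in> sw_entourage B \<epsilon> \<longleftrightarrow> f \<in> cont_funs \<and> g \<in> cont_funs \<and>
     (\<exists>\<delta>>0. \<forall>x\<in>enlargement B \<delta>. \<bar>f x - g x\<bar> < \<epsilon> x)"
  by (auto simp: sw_entourage_def)

lemma add_mem_sw_entourage_Image:
  assumes "f \<in> cont_funs" "h \<in> cont_funs" "\<delta> > 0"
    and "\<And>x. x \<in> enlargement B \<delta> \<Longrightarrow> \<bar>h x\<bar> < \<epsilon> x"
  shows "(\<lambda>x. f x + h x) \<in> sw_entourage B \<epsilon> `` {f}"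
  unfolding Image_singleton_iff mem_sw_entourage_iff using assms
  by (auto simp: cont_funs_def intro!: continuous_intros)

lemma sw_entourage_Image_mono:
  assumes "B \<subseteq> B'" "\<delta> > 0" "\<And>x. x \<in> enlargement B \<delta> \<Longrightarrow> \<epsilon>' x \<le> \<epsilon> x"
  shows "sw_entourage B' \<epsilon>' `` {f} \<subseteq> sw_entourage B \<epsilon> `` {f}"
proof
  fix g assume "g \<in> sw_entourage B' \<epsilon>' `` {f}"
  then obtain \<eta> where *: "f \<in> cont_funs" "g \<in> cont_funs" "\<eta> > 0"
    "\<And>x. x \<in> enlargement B' \<eta> \<Longrightarrow> \<bar>f x - g x\<bar> < \<epsilon>' x"
    by (auto simp: mem_sw_entourage_iff)
  have "\<bar>f x - g x\<bar> < \<epsilon> x" if "x \<in> enlargement B (min \<delta> \<eta>)" for x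
  proof -
    have "x \<in> enlargement B \<delta>" "x \<in> enlargement B' \<eta>"
      using that enlargement_mono[OF order_refl min.cobounded1]
        enlargement_mono[OF assms(1) min.cobounded2] by blast+
    then show ?thesis using *(4) assms(3) by fastforce
  qed
  then show "g \<in> sw_entourage B \<epsilon> `` {f}"
    using * assms(2) unfolding Image_singleton_iff mem_sw_entourage_iff
    by (intro conjI exI[of _ "min \<delta> \<eta>"]) auto
qed

lemma sw_neighbourhood_contains_entourage:
  assumes "bornology \<B>" "openin (sw_topology \<B>) U" "f \<in> U"
  obtains B \<epsilon> where "B \<in> \<B>" "\<epsilon> \<in> pos_cont_funs" "sw_entourage B \<epsilon> `` {f} \<subseteq> U"
  using assms(2,3) unfolding openin_sw_topology eventually_sw_uniformity[OF assms(1)] by fast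

text \<open>If \<open>\<bar>f - g\<bar> < \<epsilon>\<close> on the \<open>\<delta>\<close>-enlargement of \<open>B\<close>, then the slack \<open>\<epsilon> - \<bar>f - g\<bar>\<close> is a tolerance
  that works for \<open>g\<close>, except that it need not be positive far from \<open>B\<close>. Taking the maximum with
  \<open>infdist x B - \<delta>/2\<close> repairs this without changing it near \<open>B\<close>.\<close>

lemma openin_sw_entourage_Image:
  assumes "bornology \<B>" "B \<in> \<B>" "\<epsilon> \<in> pos_cont_funs"
  shows "openin (sw_topology \<B>) (sw_entourage B \<epsilon> `` {f})"
  unfolding openin_sw_topology eventually_sw_uniformity[OF assms(1)]
proof (intro conjI ballI)
  show "sw_entourage B \<epsilon> `` {f} \<subseteq> cont_funs"
    by (auto simp: mem_sw_entourage_iff)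
  have "B \<noteq> {}" using assms by (auto simp: bornology_def)
  fix g assume "g \<in> sw_entourage B \<epsilon> `` {f}"
  then obtain \<delta> where g: "f \<in> cont_funs" "g \<in> cont_funs" "\<delta> > 0"
    "\<And>x. x \<in> enlargement B \<delta> \<Longrightarrow> \<bar>f x - g x\<bar> < \<epsilon> x"
    by (auto simp: mem_sw_entourage_iff)
  define \<eta> where "\<eta> x = max (\<epsilon> x - \<bar>f x - g x\<bar>) (infdist x B - \<delta> / 2)" for x
  have "continuous_on UNIV \<eta>"
    using g assms(3) unfolding \<eta>_def cont_funs_def pos_cont_funs_def
    by (auto intro!: continuous_intros)
  moreover have "\<eta> x > 0" for x
  proof (cases "infdist x B < \<delta>")
    case True
    then have "\<bar>f x - g x\<bar> < \<epsilon> x"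
      using g(4) mem_enlargement_iff_infdist[OF \<open>B \<noteq> {}\<close>] by blast
    then show ?thesis by (simp add: \<eta>_def)
  next
    case False
    then show ?thesis using \<open>\<delta> > 0\<close> by (simp add: \<eta>_def less_max_iff_disj)
  qed
  ultimately have \<eta>: "\<eta> \<in> pos_cont_funs"
    by (simp add: pos_cont_funs_def cont_funs_def)
  have "k \<in> sw_entourage B \<epsilon> `` {f}" if k: "k \<in> sw_entourage B \<eta> `` {g}" for k
  proof -
    from k obtain \<delta>' where k: "k \<in> cont_funs" "\<delta>' > 0"
      "\<And>x. x \<in> enlargement B \<delta>' \<Longrightarrow> \<bar>g x - k x\<bar> < \<eta> x"
      by (auto simp: mem_sw_entourage_iff)
    have "\<bar>f x - k x\<bar> < \<epsilon> x" if "x \<in> enlargement B (min \<delta>' (\<delta> / 2))" for x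
    proof -
      have x: "infdist x B < \<delta>'" "infdist x B < \<delta> / 2"
        using that by (simp_all add: mem_enlargement_iff_infdist[OF \<open>B \<noteq> {}\<close>])
      then have "\<bar>g x - k x\<bar> < \<eta> x" "\<bar>f x - g x\<bar> < \<epsilon> x"
        using k(3) g(3,4) by (simp_all add: mem_enlargement_iff_infdist[OF \<open>B \<noteq> {}\<close>])
      then show ?thesis using x(2) by (auto simp: \<eta>_def max_def split: if_splits)
    qed
    then show ?thesis
      using g k unfolding Image_singleton_iff mem_sw_entourage_iff
      by (intro conjI exI[of _ "min \<delta>' (\<delta> / 2)"]) auto
  qed
  then show "\<exists>B'\<in>\<B>. \<exists>\<epsilon>'\<in>pos_cont_funs. \<forall>p\<in>sw_entourage B' \<epsilon>'.
      case p of (f', k) \<Rightarrow> f' = g \<longrightarrow> k \<in> sw_entourage B \<epsilon> `` {f}"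
    using assms(2) \<eta> by (intro bexI[of _ B] bexI[of _ \<eta>]) auto
qed

lemma mem_sw_entourage_Image_self:
  assumes "f \<in> cont_funs" "\<epsilon> \<in> pos_cont_funs"
  shows "f \<in> sw_entourage B \<epsilon> `` {f}"
  using assms by (auto simp: mem_sw_entourage_iff pos_cont_funs_def intro: exI[of _ 1])

section \<open>The upper bound\<close>

text \<open>For a tolerance \<open>\<epsilon>\<close>, domination of \<open>1/\<epsilon>\<close> by \<open>g\<close> near \<open>B\<close> gives \<open>1/(1 + \<bar>g\<bar>) \<le> \<epsilon>\<close> there;
  the expression \<open>1 + \<bar>g\<bar>\<close> is used because members of a dominating set may vanish or be
  negative.\<close>

lemma local_base_of_base_and_dominating:
  assumes "bornology \<B>" "f \<in> cont_funs" "bornology_base \<B> \<B>\<^sub>0" "strongly_dominating \<B> F"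
  shows "local_base (sw_topology \<B>) f
    ((\<lambda>(B, g). sw_entourage B (\<lambda>x. 1 / (1 + \<bar>g x\<bar>)) `` {f}) ` (\<B>\<^sub>0 \<times> F))"
  unfolding local_base_def
proof (intro conjI ballI allI impI; (elim imageE conjE)?)
  have pos: "(\<lambda>x. 1 / (1 + \<bar>g x\<bar>)) \<in> pos_cont_funs" if "g \<in> F" for g
  proof -
    have "continuous_on UNIV g"
      using that assms(4) by (auto simp: strongly_dominating_def cont_funs_def)
    moreover have "1 + \<bar>g x\<bar> > 0" for x by linarith
    ultimately show ?thesis
      by (auto simp: pos_cont_funs_def cont_funs_def less_imp_neq[symmetric]
          intro!: continuous_on_divide continuous_on_add continuous_on_const continuous_on_rabs)
  qed
  fix V p assume p: "p \<in> \<B>\<^sub>0 \<times> F"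
    and V: "V = (case p of (B, g) \<Rightarrow> sw_entourage B (\<lambda>x. 1 / (1 + \<bar>g x\<bar>)) `` {f})"
  from p obtain B g where "p = (B, g)" "B \<in> \<B>" "g \<in> F"
    using assms(3) by (auto simp: bornology_base_def)
  then show "openin (sw_topology \<B>) V" "f \<in> V"
    using V openin_sw_entourage_Image[OF assms(1) _ pos]
      mem_sw_entourage_Image_self[OF assms(2) pos] by simp_all
next
  fix U assume "openin (sw_topology \<B>) U" "f \<in> U"
  then obtain B \<epsilon> where B: "B \<in> \<B>" and \<epsilon>: "\<epsilon> \<in> pos_cont_funs"
    and U: "sw_entourage B \<epsilon> `` {f} \<subseteq> U"
    using sw_neighbourhood_contains_entourage[OF assms(1)] by blast
  obtain B' where B': "B' \<in> \<B>\<^sub>0" "B \<subseteq> B'"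
    using assms(3) B by (auto simp: bornology_base_def)
  have \<epsilon>_pos: "\<epsilon> x > 0" for x using \<epsilon> by (simp add: pos_cont_funs_def)
  then have "(\<lambda>x. 1 / \<epsilon> x) \<in> cont_funs"
    using \<epsilon> by (auto simp: pos_cont_funs_def cont_funs_def less_imp_neq[symmetric]
        intro!: continuous_intros)
  then have "\<exists>\<delta>>0. \<exists>g\<in>F. \<forall>x\<in>enlargement B \<delta>. 1 / \<epsilon> x \<le> g x"
    using assms(4) B unfolding strongly_dominating_def
    by (auto dest!: bspec[where x = "\<lambda>x. 1 / \<epsilon> x"])
  then obtain \<delta> g where g: "\<delta> > 0" "g \<in> F" "\<And>x. x \<in> enlargement B \<delta> \<Longrightarrow> 1 / \<epsilon> x \<le> g x"
    by blast
  have "1 / (1 + \<bar>g x\<bar>) \<le> \<epsilon> x" if "x \<in> enlargement B \<delta>" for x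
  proof -
    have "1 / \<epsilon> x \<le> 1 + \<bar>g x\<bar>" using g(3)[OF that] by linarith
    then show ?thesis using \<epsilon>_pos[of x] by (simp add: field_simps)
  qed
  then have "sw_entourage B' (\<lambda>x. 1 / (1 + \<bar>g x\<bar>)) `` {f} \<subseteq> sw_entourage B \<epsilon> `` {f}"
    by (intro sw_entourage_Image_mono[OF B'(2) g(1)])
  also note U
  finally have "sw_entourage B' (\<lambda>x. 1 / (1 + \<bar>g x\<bar>)) `` {f} \<subseteq> U" .
  with B' g(2) show "\<exists>V\<in>(\<lambda>(B, g). sw_entourage B (\<lambda>x. 1 / (1 + \<bar>g x\<bar>)) `` {f}) ` (\<B>\<^sub>0 \<times> F). V \<subseteq> U"
    by (intro bexI[OF _ imageI[of "(B', g)"]]) auto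
qed

lemma bornology_base_self: "bornology_base \<B> \<B>"
  by (auto simp: bornology_base_def)

lemma strongly_dominating_cont_funs: "strongly_dominating \<B> cont_funs"
  unfolding strongly_dominating_def by (blast intro: zero_less_one order_refl)

lemma character_at_sw_topology_le:
  assumes "bornology \<B>" "f \<in> cont_funs"
  shows "character_at (sw_topology \<B>) f \<le>o strong_domination_number \<B> *c bornology_weight \<B>"
proof -
  let ?D = "{F. strongly_dominating \<B> F}" and ?W = "{\<B>\<^sub>0. bornology_base \<B> \<B>\<^sub>0}"
  have ne: "?D \<noteq> {}" "?W \<noteq> {}"
    using bornology_base_self strongly_dominating_cont_funs by blast+
  obtain F where F: "strongly_dominating \<B> F" "min_card ?D = |F|"
    using min_card_attained[OF ne(1)] by blast
  obtain \<B>\<^sub>0 where \<B>\<^sub>0: "bornology_base \<B> \<B>\<^sub>0" "min_card ?W = |\<B>\<^sub>0|"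
    using min_card_attained[OF ne(2)] by blast
  let ?\<V> = "(\<lambda>(B, g). sw_entourage B (\<lambda>x. 1 / (1 + \<bar>g x\<bar>)) `` {f}) ` (\<B>\<^sub>0 \<times> F)"
  have "|F| \<le>o strong_domination_number \<B>" "|\<B>\<^sub>0| \<le>o bornology_weight \<B>"
    using min_card_le_natLeq_csum[OF ne(1)] min_card_le_natLeq_csum[OF ne(2)] F(2) \<B>\<^sub>0(2)
    unfolding strong_domination_number_def bornology_weight_def by simp_all
  then have "|F| *c |\<B>\<^sub>0| \<le>o strong_domination_number \<B> *c bornology_weight \<B>"
    by (rule cprod_mono)
  moreover have "|?\<V>| \<le>o |F| *c |\<B>\<^sub>0|"
  proof -
    have "|?\<V>| \<le>o |\<B>\<^sub>0 \<times> F|" by (rule card_of_image)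
    also have "|\<B>\<^sub>0 \<times> F| =o |F \<times> \<B>\<^sub>0|" by (rule card_of_Times_commute)
    finally show ?thesis by (simp add: cprod_def Field_card_of)
  qed
  ultimately have "|?\<V>| \<le>o strong_domination_number \<B> *c bornology_weight \<B>"
    by (rule ordLeq_transitive[rotated])
  moreover have "?\<V> \<in> {\<V>. local_base (sw_topology \<B>) f \<V>}"
    using local_base_of_base_and_dominating[OF assms \<B>\<^sub>0(1) F(1)] by simp
  moreover have "Cinfinite (strong_domination_number \<B> *c bornology_weight \<B>)"
    unfolding strong_domination_number_def bornology_weight_def
    by (intro Cinfinite_cprod2 Cinfinite_Cnotzero Cinfinite_natLeq_csum)
  ultimately show ?thesis
    unfolding character_at_def by (intro natLeq_csum_min_card_le)
qed

section \<open>The lower bound\<close>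

text \<open>Were some point \<open>x\<close> of \<open>B\<close> at positive distance \<open>r\<close> from \<open>C\<close>, then adding to \<open>f\<close> a function
  that vanishes on the \<open>r/2\<close>-enlargement of \<open>C\<close> and equals \<open>\<epsilon> x\<close> at \<open>x\<close> would stay in the
  neighbourhood with set \<open>C\<close> but leave the one with set \<open>B\<close>.\<close>

lemma subset_closure_of_sw_entourage_subset:
  assumes "f \<in> cont_funs" "C \<noteq> {}" "\<epsilon> \<in> pos_cont_funs" "\<eta> \<in> pos_cont_funs"
    and sub: "sw_entourage C \<eta> `` {f} \<subseteq> sw_entourage B \<epsilon> `` {f}"
  shows "B \<subseteq> closure C"
proof (rule subsetI, rule ccontr)
  fix x assume x: "x \<in> B" "x \<notin> closure C"
  define r where "r = infdist x C"
  have "r > 0"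
    using x(2) in_closure_iff_infdist_zero[OF assms(2)] infdist_nonneg[of x C]
    unfolding r_def by (metis less_le)
  define h where "h y = (2 * \<epsilon> x / r) * max 0 (infdist y C - r / 2)" for y
  have "h \<in> cont_funs"
    using \<open>r > 0\<close> unfolding h_def cont_funs_def by (auto intro!: continuous_intros)
  moreover have "\<bar>h y\<bar> < \<eta> y" if "y \<in> enlargement C (r / 2)" for y
    using that assms(4) by (simp add: mem_enlargement_iff_infdist[OF assms(2)] h_def pos_cont_funs_def)
  ultimately have "(\<lambda>y. f y + h y) \<in> sw_entourage C \<eta> `` {f}"
    using \<open>r > 0\<close> assms(1) by (intro add_mem_sw_entourage_Image[of _ _ "r / 2"]) auto
  with sub have "(\<lambda>y. f y + h y) \<in> sw_entourage B \<epsilon> `` {f}"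
    by blast
  then obtain \<delta> where "\<delta> > 0" "\<And>y. y \<in> enlargement B \<delta> \<Longrightarrow> \<bar>h y\<bar> < \<epsilon> y"
    by (auto simp: mem_sw_entourage_iff)
  then have "\<bar>h x\<bar> < \<epsilon> x" using subset_enlargement x(1) by blast
  moreover have "h x = \<epsilon> x" using \<open>r > 0\<close> by (simp add: h_def flip: r_def)
  ultimately show False by simp
qed

lemma tolerance_le_of_sw_entourage_subset:
  assumes "f \<in> cont_funs" "\<eta> \<in> pos_cont_funs"
    and sub: "sw_entourage C \<eta> `` {f} \<subseteq> sw_entourage B \<epsilon> `` {f}"
  obtains \<delta> where "\<delta> > 0" "\<And>x. x \<in> enlargement B \<delta> \<Longrightarrow> \<eta> x / 2 < \<epsilon> x"
proof -
  have \<eta>: "\<eta> x > 0" for x using assms(2) by (simp add: pos_cont_funs_def)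
  have "(\<lambda>x. \<eta> x / 2) \<in> cont_funs"
    using assms(2) by (auto simp: pos_cont_funs_def cont_funs_def intro!: continuous_intros)
  then have "(\<lambda>x. f x + \<eta> x / 2) \<in> sw_entourage C \<eta> `` {f}"
    using assms(1) \<eta> by (intro add_mem_sw_entourage_Image[of _ _ 1]) (auto simp: abs_of_pos)
  with sub have "(\<lambda>x. f x + \<eta> x / 2) \<in> sw_entourage B \<epsilon> `` {f}"
    by blast
  then obtain \<delta> where "\<delta> > 0" "\<And>x. x \<in> enlargement B \<delta> \<Longrightarrow> \<bar>\<eta> x / 2\<bar> < \<epsilon> x"
    by (auto simp: mem_sw_entourage_iff)
  then show thesis using that by fastforce
qed

text \<open>Enlarging the set shrinks a basic neighbourhood, so the set may be taken from a closed
  base.\<close>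

lemma local_base_contains_closed_entourages:
  assumes "bornology \<B>" "has_closed_base \<B>" "local_base (sw_topology \<B>) f \<V>"
  obtains \<beta> \<eta> where "\<And>V. V \<in> \<V> \<Longrightarrow> \<beta> V \<in> \<B> \<and> closed (\<beta> V) \<and> \<eta> V \<in> pos_cont_funs \<and>
    sw_entourage (\<beta> V) (\<eta> V) `` {f} \<subseteq> V"
proof -
  have "\<exists>B \<epsilon>. B \<in> \<B> \<and> closed B \<and> \<epsilon> \<in> pos_cont_funs \<and> sw_entourage B \<epsilon> `` {f} \<subseteq> V"
    if "V \<in> \<V>" for V
  proof -
    have "openin (sw_topology \<B>) V" "f \<in> V"
      using assms(3) that by (auto simp: local_base_def)
    then obtain B \<epsilon> where B: "B \<in> \<B>" "\<epsilon> \<in> pos_cont_funs" "sw_entourage B \<epsilon> `` {f} \<subseteq> V"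
      using sw_neighbourhood_contains_entourage[OF assms(1)] by blast
    obtain B' where "B' \<in> \<B>" "closed B'" "B \<subseteq> B'"
      using assms(2) B(1) unfolding has_closed_base_def bornology_base_def by blast
    moreover from sw_entourage_Image_mono[OF \<open>B \<subseteq> B'\<close> zero_less_one order_refl]
    have "sw_entourage B' \<epsilon> `` {f} \<subseteq> V" using B(3) by blast
    ultimately show ?thesis using B(2) by blast
  qed
  then show thesis using that by metis
qed

lemma local_base_member_within_entourage:
  assumes "bornology \<B>" "f \<in> cont_funs" "local_base (sw_topology \<B>) f \<V>"
    and "B \<in> \<B>" "\<epsilon> \<in> pos_cont_funs"
  obtains V where "V \<in> \<V>" "V \<subseteq> sw_entourage B \<epsilon> `` {f}"
  using assms(3) openin_sw_entourage_Image[OF assms(1,4,5)]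
    mem_sw_entourage_Image_self[OF assms(2,5)] unfolding local_base_def by meson

lemma bornology_base_of_local_base:
  assumes "bornology \<B>" "f \<in> cont_funs" "local_base (sw_topology \<B>) f \<V>"
    and \<beta>: "\<And>V. V \<in> \<V> \<Longrightarrow> \<beta> V \<in> \<B> \<and> closed (\<beta> V) \<and> \<eta> V \<in> pos_cont_funs \<and>
      sw_entourage (\<beta> V) (\<eta> V) `` {f} \<subseteq> V"
  shows "bornology_base \<B> (\<beta> ` \<V>)"
  unfolding bornology_base_def
proof (intro conjI ballI)
  show "\<beta> ` \<V> \<subseteq> \<B>" using \<beta> by blast
  fix B assume "B \<in> \<B>"
  have one: "(\<lambda>_. 1) \<in> (pos_cont_funs :: ('a \<Rightarrow> real) set)"
    by (simp add: pos_cont_funs_def cont_funs_def)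
  obtain V where V: "V \<in> \<V>" "V \<subseteq> sw_entourage B (\<lambda>_. 1) `` {f}"
    using local_base_member_within_entourage[OF assms(1-3) \<open>B \<in> \<B>\<close> one] by blast
  have "\<beta> V \<noteq> {}" using \<beta>[OF V(1)] assms(1) by (auto simp: bornology_def)
  then have "B \<subseteq> closure (\<beta> V)"
    using subset_closure_of_sw_entourage_subset[OF assms(2) _ one] \<beta>[OF V(1)] V(2)
    by (meson order_trans)
  then show "\<exists>B'\<in>\<beta> ` \<V>. B \<subseteq> B'"
    using V(1) \<beta>[OF V(1)] by auto
qed

lemma strongly_dominating_of_local_base:
  assumes "bornology \<B>" "f \<in> cont_funs" "local_base (sw_topology \<B>) f \<V>"
    and \<eta>: "\<And>V. V \<in> \<V> \<Longrightarrow> \<eta> V \<in> pos_cont_funs \<and> sw_entourage (\<beta> V) (\<eta> V) `` {f} \<subseteq> V"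
  shows "strongly_dominating \<B> ((\<lambda>V x. 2 / \<eta> V x) ` \<V>)"
  unfolding strongly_dominating_def
proof (intro conjI ballI)
  have pos: "\<eta> V x > 0" if "V \<in> \<V>" for V x
    using \<eta>[OF that] by (simp add: pos_cont_funs_def)
  show "(\<lambda>V x. 2 / \<eta> V x) ` \<V> \<subseteq> cont_funs"
    using \<eta> pos by (auto simp: pos_cont_funs_def cont_funs_def less_imp_neq[symmetric]
        intro!: continuous_intros)
  fix g :: "'a \<Rightarrow> real" and B assume g: "g \<in> cont_funs" and "B \<in> \<B>"
  \<comment> \<open>Truncating \<open>g\<close> below at \<open>1\<close> makes its reciprocal a tolerance.\<close>
  define \<epsilon> where "\<epsilon> x = 1 / max 1 (g x)" for x
  have "max 1 (g x) \<noteq> 0" for x by (simp add: max_def)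
  then have "continuous_on UNIV \<epsilon>"
    using g unfolding \<epsilon>_def cont_funs_def by (auto intro!: continuous_intros)
  then have "\<epsilon> \<in> pos_cont_funs"
    by (auto simp: pos_cont_funs_def cont_funs_def \<epsilon>_def)
  then obtain V where V: "V \<in> \<V>" "V \<subseteq> sw_entourage B \<epsilon> `` {f}"
    using local_base_member_within_entourage[OF assms(1-3) \<open>B \<in> \<B>\<close>] by blast
  then have "\<eta> V \<in> pos_cont_funs"
    and "sw_entourage (\<beta> V) (\<eta> V) `` {f} \<subseteq> sw_entourage B \<epsilon> `` {f}"
    using \<eta> by blast+
  then obtain \<delta> where \<delta>: "\<delta> > 0" "\<And>x. x \<in> enlargement B \<delta> \<Longrightarrow> \<eta> V x / 2 < \<epsilon> x"
    using tolerance_le_of_sw_entourage_subset[OF assms(2)] by metis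
  have "g x \<le> 2 / \<eta> V x" if "x \<in> enlargement B \<delta>" for x
  proof -
    have "max 1 (g x) * \<eta> V x < 2"
      using \<delta>(2)[OF that] by (simp add: \<epsilon>_def field_simps)
    then have "max 1 (g x) \<le> 2 / \<eta> V x"
      by (simp only: pos_le_divide_eq[OF pos[OF V(1)]] less_imp_le)
    then show ?thesis by simp
  qed
  then show "\<exists>\<delta>>0. \<exists>h\<in>(\<lambda>V x. 2 / \<eta> V x) ` \<V>. \<forall>x\<in>enlargement B \<delta>. g x \<le> h x"
    using \<delta>(1) by (intro exI[of _ \<delta>] conjI bexI[OF _ imageI[OF V(1)]]) auto
qed

lemma character_at_sw_topology_ge:
  assumes "bornology \<B>" "has_closed_base \<B>" "f \<in> cont_funs"
  shows "strong_domination_number \<B> *c bornology_weight \<B> \<le>o character_at (sw_topology \<B>) f"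
proof -
  let ?L = "{\<V>. local_base (sw_topology \<B>) f \<V>}" and ?\<chi> = "character_at (sw_topology \<B>) f"
  have inf: "Cinfinite ?\<chi>"
    unfolding character_at_def by (rule Cinfinite_natLeq_csum)
  have ne: "?L \<noteq> {}"
    using local_base_of_base_and_dominating[OF assms(1,3) bornology_base_self
        strongly_dominating_cont_funs] by blast
  obtain \<V> where \<V>: "local_base (sw_topology \<B>) f \<V>" "min_card ?L = |\<V>|"
    using min_card_attained[OF ne] by blast
  have image_le: "|k ` \<V>| \<le>o ?\<chi>" for k :: "_ \<Rightarrow> 'c"
    using card_of_image[of k \<V>] min_card_le_natLeq_csum[OF ne] \<V>(2)
    unfolding character_at_def by (metis ordLeq_transitive)
  obtain \<beta> \<eta> where \<beta>\<eta>: "\<And>V. V \<in> \<V> \<Longrightarrow> \<beta> V \<in> \<B> \<and> closed (\<beta> V) \<and> \<eta> V \<in> pos_cont_funs \<and>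
      sw_entourage (\<beta> V) (\<eta> V) `` {f} \<subseteq> V"
    using local_base_contains_closed_entourages[OF assms(1,2) \<V>(1)] by blast
  have base: "bornology_base \<B> (\<beta> ` \<V>)"
    by (rule bornology_base_of_local_base[OF assms(1,3) \<V>(1) \<beta>\<eta>])
  have dom: "strongly_dominating \<B> ((\<lambda>V x. 2 / \<eta> V x) ` \<V>)"
    by (rule strongly_dominating_of_local_base[OF assms(1,3) \<V>(1)]) (use \<beta>\<eta> in blast)
  have "bornology_weight \<B> \<le>o ?\<chi>"
    unfolding bornology_weight_def
    by (rule natLeq_csum_min_card_le[of "\<beta> ` \<V>", OF _ image_le inf]) (use base in simp)
  moreover have "strong_domination_number \<B> \<le>o ?\<chi>"
    unfolding strong_domination_number_def
    by (rule natLeq_csum_min_card_le[of "(\<lambda>V x. 2 / \<eta> V x) ` \<V>", OF _ image_le inf])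
      (use dom in simp)
  ultimately show ?thesis
    using inf unfolding strong_domination_number_def bornology_weight_def
    by (intro cprod_cinfinite_bound) (auto simp: Card_order_csum)
qed

section \<open>The character\<close>

theorem theorem3p12:
  fixes \<B> :: "'a::metric_space set set"
  assumes "\<exists>x y :: 'a. x \<noteq> y"
    and "bornology \<B>"
    and "has_closed_base \<B>"
  shows "character (sw_topology \<B>) =o strong_domination_number \<B> *c bornology_weight \<B>"
proof -
  let ?R = "character_at (sw_topology \<B>) ` topspace (sw_topology \<B>)"
  have Card_order: "Card_order r" if "r \<in> ?R" for r
    using that by (auto simp: character_at_def Card_order_csum)
  have "csup ?R \<le>o strong_domination_number \<B> *c bornology_weight \<B>"
    using character_at_sw_topology_le[OF assms(2)]
    by (intro csup_least Card_order) (auto simp: topspace_sw_topology[OF assms(2)] Card_order_cprod)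
  moreover have "strong_domination_number \<B> *c bornology_weight \<B> \<le>o csup ?R"
  proof -
    have zero: "(\<lambda>_. 0) \<in> (cont_funs :: ('a \<Rightarrow> real) set)"
      by (simp add: cont_funs_def)
    then have "character_at (sw_topology \<B>) (\<lambda>_. 0) \<le>o csup ?R"
      by (intro csup_upper Card_order) (auto simp: topspace_sw_topology[OF assms(2)])
    with character_at_sw_topology_ge[OF assms(2,3) zero] show ?thesis
      by (rule ordLeq_transitive)
  qed
  ultimately show ?thesis
    unfolding character_def by (simp add: ordIso_iff_ordLeq)
qed

end
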